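(* Let $N\ge 1$ and let $\boldsymbol u:[0,\infty)\to\mathbb R^N$ be a $C^1$ solution of the discrete gradient flow $$\dot{\boldsymbol u}_i(t)=-\big(\mathcal L^*_{\boldsymbol u(t)}\tilde{\boldsymbol m}(t)\big)_i,\qquad \tilde{\boldsymbol m}_i(t)=e^{G_i(\boldsymbol u(t))},\qquad i\in\{1,\dots,N\}.$$ Then $t\mapsto\phi(\boldsymbol u(t))$ is nonincreasing, $\frac{d}{dt}\sum_{i=1}^N\boldsymbol u_i(t)=0$, $\boldsymbol u(t)$ is bounded, and $\boldsymbol u(t)$ converges as $t\to\infty$ to a critical point $u\in\mathbb R^N$ of $\phi$. Moreover, normalizing $\tilde m_i=e^{G_i(u)}$ as $m_i=e^{-\overline H}\tilde m_i$, with $\overline H\in\mathbb R$ such that $h\sum_{i=1}^N m_i=1$, gives a solution $(m,u,\overline H)$ of $$G_i(u)=\ln m_i+\overline H,\qquad (\mathcal L_u^*m)_i=0,\qquad i\in\{1,\dots,N\}.$$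
   Context: $\mathbb T=\mathbb R/\mathbb Z$, identified with $[0,1]$, and $V,b:\mathbb T\to\mathbb R$ are given $C^\infty$ functions. $F:\mathbb R\times\mathbb R\times\mathbb T\to\mathbb R$ is a function, differentiable in $(p,q)$, such that: (1) $F(p,q,x)$ is jointly convex in $(p,q)$ for each $x$; (2) $p\mapsto F(p,q,x)$ and $q\mapsto F(p,q,x)$ are nondecreasing; (3) $F(-p,p,x)=\frac{p^2}{2}+b(x)p+V(x)$; (4) there is a constant $c>0$ such that $F(-p,q,x)+F(q',p,x')\ge-\frac1c+c\,p^2$ for all $p,q,q'\in\mathbb R$, $x,x'\in\mathbb T$. For $N\ge1$, set $h=\frac1N$ and $x_i=\frac iN$, $i\in\{1,\dots,N\}$. For $u\in\mathbb R^N$ use the periodicity convention $u_0=u_N$, $u_{N+1}=u_1$. Define $G:\mathbb R^N\to\mathbb R^N$ by $G_i(u)=F\big(\frac{u_i-u_{i+1}}h,\frac{u_i-u_{i-1}}h,x_i\big)$. $\mathcal L_u:\mathbb R^N\to\mathbb R^N$ is the linearization (differential) of $G$ at $u$, and $\mathcal L_u^*$ is its adjoint (transpose), i.e. $(\mathcal L_u^*w)_i=\sum_{j=1}^N\frac{\partial G_j}{\partial u_i}(u)\,w_j$. The function $\phi:\mathbb R^N\to\mathbb R$ is $\phi(u)=\sum_{i=1}^N h\,e^{G_i(u)}$. A critical point of $\phi$ is a point where its gradient vanishes. *)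

theory Defs
  imports "HOL-Analysis.Analysis"
begin

(* Functions on the circle R/Z are represented by 1-periodic functions on the reals. *)
definition on_circle :: "(real \<Rightarrow> 'a) \<Rightarrow> bool" where
  "on_circle f \<longleftrightarrow> (\<forall>x. f (x + 1) = f x)"

definition smooth :: "(real \<Rightarrow> real) \<Rightarrow> bool" where
  "smooth f \<longleftrightarrow> (\<forall>k x. (deriv ^^ k) f differentiable (at x))"

(* R^N is real ^ 'n with N = CARD('n).  The periodic difference scheme needs the indices
   to be numbered 1, ..., N; this is the job of the labelling lab. *)
definition labelling :: "('n::finite \<Rightarrow> nat) \<Rightarrow> bool" where
  "labelling lab \<longleftrightarrow> bij_betw lab UNIV {1..CARD('n)}"

definition mesh :: "'n::finite itself \<Rightarrow> real" where
  "mesh _ = 1 / real CARD('n)"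

definition node :: "('n::finite \<Rightarrow> nat) \<Rightarrow> 'n \<Rightarrow> real" where
  "node lab i = real (lab i) / real CARD('n)"

(* The component u_k for k = 0, ..., N + 1, with u_0 = u_N and u_(N+1) = u_1. *)
definition comp :: "('n::finite \<Rightarrow> nat) \<Rightarrow> real ^ 'n \<Rightarrow> nat \<Rightarrow> real" where
  "comp lab u k =
     u $ inv lab (if k = 0 then CARD('n) else if k = CARD('n) + 1 then 1 else k)"

definition G ::
  "(real \<Rightarrow> real \<Rightarrow> real \<Rightarrow> real) \<Rightarrow> ('n::finite \<Rightarrow> nat) \<Rightarrow> real ^ 'n \<Rightarrow> real ^ 'n" where
  "G F lab u = (\<chi> i.
     F ((comp lab u (lab i) - comp lab u (lab i + 1)) / mesh TYPE('n))
       ((comp lab u (lab i) - comp lab u (lab i - 1)) / mesh TYPE('n))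
       (node lab i))"

definition linearization ::
  "(real \<Rightarrow> real \<Rightarrow> real \<Rightarrow> real) \<Rightarrow> ('n::finite \<Rightarrow> nat) \<Rightarrow> real ^ 'n \<Rightarrow> real ^ 'n \<Rightarrow> real ^ 'n" where
  "linearization F lab u = frechet_derivative (G F lab) (at u)"

definition phi ::
  "(real \<Rightarrow> real \<Rightarrow> real \<Rightarrow> real) \<Rightarrow> ('n::finite \<Rightarrow> nat) \<Rightarrow> real ^ 'n \<Rightarrow> real" where
  "phi F lab u = (\<Sum>i\<in>UNIV. mesh TYPE('n) * exp (G F lab u $ i))"

definition gradient :: "(real ^ 'n::finite \<Rightarrow> real) \<Rightarrow> real ^ 'n \<Rightarrow> real ^ 'n" where
  "gradient f u = (\<chi> i. frechet_derivative f (at u) (axis i 1))"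

definition critical_point :: "(real ^ 'n::finite \<Rightarrow> real) \<Rightarrow> real ^ 'n \<Rightarrow> bool" where
  "critical_point f u \<longleftrightarrow> f differentiable (at u) \<and> gradient f u = 0"

end

theory Submission
  imports Defs
begin

text \<open>
  Write \<open>f(u) = \<Sum>\<^sub>i exp (G\<^sub>i(u))\<close>, so that \<open>\<phi> = h f\<close>.  The chain rule gives
  \<open>\<nabla>f(u) = L\<^sub>u\<^sup>* exp(G(u))\<close>; hence the discrete flow is the gradient flow of \<open>f\<close>, and along
  it \<open>f\<close> decreases.  Each \<open>G\<^sub>i\<close> is a convex function of difference quotients of \<open>u\<close>, so \<open>f\<close>
  is convex (\<open>convex_exp_sum\<close>), and it does not change when a constant is added to \<open>u\<close>, which
  makes \<open>\<nabla>f\<close> orthogonal to constants and \<open>\<Sum>\<^sub>i u\<^sub>i\<close> a conserved quantity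
  (\<open>gradient_exp_sum_orthogonal\<close>).

  Convergence rests on the fact that a gradient flow of a convex function never moves away from
  a minimiser: if \<open>z\<close> minimises \<open>f\<close>, then
  \<open>d/dt \<bar>u - z\<bar>\<^sup>2 = 2 \<nabla>f(u) \<bullet> (z - u) \<le> 2 (f(z) - f(u)) \<le> 0\<close>.  This bounds the trajectory.
  Integrating the same inequality, with \<open>f(u(t))\<close> decreasing, gives
  \<open>f(u(T)) - f(z) \<le> \<bar>u(0) - z\<bar>\<^sup>2 / (2 T)\<close>, so every cluster point of the trajectory is again a
  minimiser.  The distance to that cluster point is itself nonincreasing and comes arbitrarily
  close to zero, so the whole trajectory converges to it (\<open>converges_to_minimiser\<close>).

  A minimiser exists by coercivity.  The slope \<open>p\<close> between two neighbouring nodes enters \<open>G\<close> at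
  the left node as \<open>-p\<close> in the first argument of \<open>F\<close> and at the right node as \<open>p\<close> in the second
  argument, so the sum of these two values of \<open>G\<close> is at least \<open>c p\<^sup>2 - 1/c\<close>
  (\<open>exp_sum_bounds_increment\<close>).  On a sublevel set of \<open>f\<close> all increments of \<open>u\<close> are
  therefore bounded, which makes the sublevel set bounded once \<open>\<Sum>\<^sub>i u\<^sub>i = 0\<close> is imposed; by the
  invariance under constants this normalisation loses nothing (\<open>exp_sum_attains_minimum\<close>).

  At the limit \<open>\<nabla>f = 0\<close>, that is \<open>L\<^sub>u\<^sup>* exp(G(u)) = 0\<close>, and linearity of \<open>L\<^sub>u\<^sup>*\<close> carries this
  over to the normalised density \<open>m\<close>.
\<close>

section \<open>Gradient flows of convex functions\<close>

text \<open>Along the segment from \<open>x\<close> to \<open>y\<close> this is the tangent inequality for convex functions of one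
  real variable.\<close>

lemma convex_above_tangent:
  fixes f :: "'a::real_normed_vector \<Rightarrow> real"
  assumes conv: "convex_on UNIV f" and der: "(f has_derivative D) (at x)"
  shows "f x + D (y - x) \<le> f y"
proof -
  define \<gamma> where "\<gamma> = (\<lambda>s::real. f (x + s *\<^sub>R (y - x)))"
  have "convex_on UNIV \<gamma>"
    unfolding convex_on_def
  proof (intro conjI ballI allI impI)
    fix s t a b :: real
    assume ab: "a \<ge> 0" "b \<ge> 0" "a + b = 1"
    have "x + (a * s + b * t) *\<^sub>R (y - x)
        = (a + b) *\<^sub>R x + (a * s + b * t) *\<^sub>R (y - x)"
      using ab by simp
    also have "\<dots> = a *\<^sub>R (x + s *\<^sub>R (y - x)) + b *\<^sub>R (x + t *\<^sub>R (y - x))"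
      by (simp add: algebra_simps)
    finally show "\<gamma> (a *\<^sub>R s + b *\<^sub>R t) \<le> a * \<gamma> s + b * \<gamma> t"
      using conv ab by (auto simp: \<gamma>_def convex_on_def)
  qed simp
  moreover have "(\<gamma> has_real_derivative D (y - x)) (at 0)"
  proof -
    have "((\<lambda>s. x + s *\<^sub>R (y - x)) has_derivative (\<lambda>s. s *\<^sub>R (y - x))) (at (0::real))"
      by (auto intro!: derivative_eq_intros)
    moreover have "(f has_derivative D) (at (x + 0 *\<^sub>R (y - x)))" using der by simp
    ultimately have "(\<gamma> has_derivative (\<lambda>s. D (s *\<^sub>R (y - x)))) (at 0)"
      unfolding \<gamma>_def by (rule has_derivative_compose)
    moreover have "linear D" using der by (rule has_derivative_linear)
    ultimately show ?thesis
      by (auto intro: has_derivative_imp_has_field_derivative simp: linear_scale)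
  qed
  ultimately have "\<gamma> 1 - \<gamma> 0 \<ge> D (y - x) * (1 - 0)"
    by (intro convex_on_imp_above_tangent[where A = UNIV]) auto
  then show ?thesis by (simp add: \<gamma>_def)
qed

lemma nonincreasing_if_derivative_nonpos:
  fixes f f' :: "real \<Rightarrow> real"
  assumes der: "\<And>t. t \<ge> 0 \<Longrightarrow> (f has_real_derivative f' t) (at t within {0..})"
    and T: "\<And>t. 0 \<le> t \<Longrightarrow> t \<le> T \<Longrightarrow> f' t \<le> 0"
    and st: "0 \<le> s" "s \<le> t" "t \<le> T"
  shows "f t \<le> f s"
proof (rule DERIV_nonpos_imp_decreasing_open[of s t f])
  fix r assume r: "s < r" "r < t"
  then have "at r within {0..} = at r"
    using st by (intro at_within_interior) (simp add: interior_real_atLeast)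
  then show "\<exists>y. (f has_real_derivative y) (at r) \<and> y \<le> 0"
    using der[of r] T[of r] r st by auto
next
  have "continuous_on {0..} f"
    using der by (intro DERIV_continuous_on) auto
  then show "continuous_on {s..t} f"
    using st by (auto intro: continuous_on_subset)
qed (use st in auto)

locale convex_gradient_flow =
  fixes f :: "'a::euclidean_space \<Rightarrow> real" and g :: "'a \<Rightarrow> 'a" and u :: "real \<Rightarrow> 'a"
  assumes convex: "convex_on UNIV f"
    and grad: "\<And>x. (f has_derivative (\<lambda>v. g x \<bullet> v)) (at x)"
    and flow: "\<And>t. t \<ge> 0 \<Longrightarrow> (u has_vector_derivative - g (u t)) (at t within {0..})"
begin

lemma energy_derivative:
  assumes "t \<ge> 0"
  shows "((\<lambda>t. f (u t)) has_real_derivative - (norm (g (u t)))\<^sup>2) (at t within {0..})"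
proof -
  have "((\<lambda>t. f (u t)) has_derivative (\<lambda>s. g (u t) \<bullet> (s *\<^sub>R - g (u t)))) (at t within {0..})"
    using flow[OF assms] grad unfolding has_vector_derivative_def
    by (rule has_derivative_compose)
  then show ?thesis
    by (rule has_derivative_imp_has_field_derivative) (simp add: power2_norm_eq_inner)
qed

lemma energy_antimono:
  assumes "0 \<le> s" "s \<le> t"
  shows "f (u t) \<le> f (u s)"
  by (rule nonincreasing_if_derivative_nonpos[OF energy_derivative _ assms order_refl]) auto

lemma distance_derivative:
  assumes "t \<ge> 0"
  shows "((\<lambda>t. (norm (u t - z))\<^sup>2) has_real_derivative 2 * (g (u t) \<bullet> (z - u t)))
    (at t within {0..})"
proof -
  have "((\<lambda>t. (u t - z) \<bullet> (u t - z)) has_derivative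
      (\<lambda>s. (u t - z) \<bullet> (s *\<^sub>R - g (u t)) + (s *\<^sub>R - g (u t)) \<bullet> (u t - z))) (at t within {0..})"
    using flow[OF assms] unfolding has_vector_derivative_def
    by (intro has_derivative_inner) (auto intro!: derivative_eq_intros)
  then show ?thesis
    unfolding power2_norm_eq_inner
    by (rule has_derivative_imp_has_field_derivative) (simp add: inner_commute algebra_simps)
qed

lemma inner_gradient_le: "g (u t) \<bullet> (z - u t) \<le> f z - f (u t)"
  using convex_above_tangent[OF convex grad[of "u t"], of z] by simp

lemma distance_to_minimiser_antimono:
  assumes z: "\<And>x. f z \<le> f x" and st: "0 \<le> s" "s \<le> t"
  shows "norm (u t - z) \<le> norm (u s - z)"
proof -
  have "(norm (u t - z))\<^sup>2 \<le> (norm (u s - z))\<^sup>2"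
  proof (rule nonincreasing_if_derivative_nonpos[OF distance_derivative _ st order_refl])
    show "2 * (g (u r) \<bullet> (z - u r)) \<le> 0" for r
      using inner_gradient_le[of r z] z[of "u r"] by linarith
  qed
  then show ?thesis by (rule power2_le_imp_le) simp
qed

text \<open>The distance to \<open>z\<close> satisfies \<open>d/dt \<bar>u - z\<bar>\<^sup>2 \<le> -2 (f(u(t)) - f(z))\<close>, and up to time \<open>T\<close> the
  right-hand side is at most \<open>-2 (f(u(T)) - f(z))\<close> because the energy decreases.  The integral
  over \<open>[0, T]\<close> is avoided by adding the corresponding linear function of time to the squared
  distance and observing that the result still decreases.\<close>

lemma energy_gap:
  assumes "T > 0"
  shows "f (u T) - f z \<le> (norm (u 0 - z))\<^sup>2 / (2 * T)"
proof -
  define W where "W = (\<lambda>t. (norm (u t - z))\<^sup>2 + 2 * t * (f (u T) - f z))"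
  have "W T \<le> W 0"
  proof (rule nonincreasing_if_derivative_nonpos[where f = W])
    show "(W has_real_derivative 2 * (g (u t) \<bullet> (z - u t)) + 2 * (f (u T) - f z))
        (at t within {0..})" if "t \<ge> 0" for t
      unfolding W_def
      by (rule DERIV_add[OF distance_derivative[OF that]]) (auto intro!: derivative_eq_intros)
    fix t assume "0 \<le> t" "t \<le> T"
    then have "g (u t) \<bullet> (z - u t) + (f (u T) - f z) \<le> 0"
      using inner_gradient_le[of t z] energy_antimono[of t T] by linarith
    then show "2 * (g (u t) \<bullet> (z - u t)) + 2 * (f (u T) - f z) \<le> 0"
      unfolding distrib_left[symmetric] by (rule mult_nonneg_nonpos[rotated]) simp
  qed (use assms in auto)
  then have "2 * T * (f (u T) - f z) \<le> (norm (u 0 - z))\<^sup>2"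
    unfolding W_def using zero_le_power2[of "norm (u T - z)"] by linarith
  then show ?thesis using assms by (simp add: field_simps)
qed

lemma trajectory_bounded:
  assumes z: "\<And>x. f z \<le> f x"
  shows "bounded (u ` {0..})"
proof -
  have "u ` {0..} \<subseteq> cball z (norm (u 0 - z))"
    using distance_to_minimiser_antimono[OF z, of 0]
    by (auto simp: dist_norm norm_minus_commute)
  then show ?thesis using bounded_cball bounded_subset by blast
qed

text \<open>The rate in \<open>energy_gap\<close> makes any cluster point \<open>w\<close> a minimiser, and the monotonicity of the
  distance to a minimiser, now applied to \<open>w\<close> itself, turns convergence along a subsequence into
  convergence.\<close>

theorem converges_to_minimiser:
  assumes z: "\<And>x. f z \<le> f x"
  obtains w where "(u \<longlongrightarrow> w) at_top" "\<And>x. f w \<le> f x"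
proof -
  have "bounded (range (\<lambda>n. u (real n)))"
    using trajectory_bounded[OF z] by (rule bounded_subset) auto
  then obtain w r where r: "strict_mono r" and lim: "(\<lambda>n. u (real (r n))) \<longlonglongrightarrow> w"
    using bounded_imp_convergent_subsequence[of "\<lambda>n. u (real n)"] by (auto simp: o_def)
  have r_top: "filterlim (\<lambda>n. real (r n)) at_top sequentially"
    using filterlim_compose[OF filterlim_real_sequentially filterlim_subseq[OF r]] .
  have "isCont f w" using grad by (rule has_derivative_continuous)
  then have lower: "(\<lambda>n. f (u (real (r n)))) \<longlonglongrightarrow> f w" using lim by (rule isCont_tendsto_compose)
  have upper: "(\<lambda>n. f z + (norm (u 0 - z))\<^sup>2 / 2 * inverse (real (r n)))
      \<longlonglongrightarrow> f z + (norm (u 0 - z))\<^sup>2 / 2 * 0"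
    by (intro tendsto_intros tendsto_inverse_0_at_top r_top)
  have "eventually (\<lambda>n. f (u (real (r n)))
      \<le> f z + (norm (u 0 - z))\<^sup>2 / 2 * inverse (real (r n))) sequentially"
    using filterlim_at_top_dense[THEN iffD1, OF r_top, rule_format, of 0]
  proof eventually_elim
    case (elim n)
    then show ?case using energy_gap[of "real (r n)" z] by (simp add: field_simps)
  qed
  then have "f w \<le> f z + (norm (u 0 - z))\<^sup>2 / 2 * 0"
    by (rule tendsto_le[OF sequentially_bot upper lower])
  then have "f w \<le> f z" by simp
  then have w: "f w \<le> f x" for x using z[of x] by linarith
  have "(u \<longlongrightarrow> w) at_top"
  proof (rule tendstoI)
    fix e :: real assume "e > 0"
    then have "eventually (\<lambda>n. dist (u (real (r n))) w < e) sequentially"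
      using lim by (simp add: tendsto_iff)
    then obtain n where n: "dist (u (real (r n))) w < e"
      by (auto simp: eventually_sequentially)
    show "eventually (\<lambda>t. dist (u t) w < e) at_top"
      using eventually_ge_at_top[of "real (r n)"]
    proof eventually_elim
      case (elim t)
      then show ?case
        using distance_to_minimiser_antimono[OF w, of "real (r n)" t] n by (simp add: dist_norm)
    qed
  qed
  then show ?thesis using w by (rule that)
qed

end

section \<open>The discrete scheme as a convex function of linear slopes\<close>

text \<open>The two arguments that the scheme feeds into \<open>F\<close> at the node \<open>i\<close>.  Isolating them
  exhibits \<open>G\<^sub>i\<close> as a convex function of two variables composed with a linear map.\<close>

definition slopes :: "('n::finite \<Rightarrow> nat) \<Rightarrow> 'n \<Rightarrow> real ^ 'n \<Rightarrow> real \<times> real" where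
  "slopes lab i u =
    ((comp lab u (lab i) - comp lab u (lab i + 1)) / mesh TYPE('n),
     (comp lab u (lab i) - comp lab u (lab i - 1)) / mesh TYPE('n))"

lemma bounded_linear_slopes: "bounded_linear (slopes lab i)"
  unfolding slopes_def comp_def
  by (intro bounded_linear_Pair bounded_linear_divide bounded_linear_sub
      bounded_linear_compose[OF bounded_linear_divide] bounded_linear_vec_nth)

lemma slopes_vec: "slopes lab i (vec s) = 0"
  by (simp add: slopes_def comp_def zero_prod_def)

lemma G_nth: "G F lab u $ i = (\<lambda>(p, q). F p q (node lab i)) (slopes lab i u)"
  by (simp add: G_def slopes_def)

lemma G_add_vec: "G F lab (u + vec s) = G F lab u"
  by (simp add: vec_eq_iff G_nth slopes_vec
      linear_add[OF bounded_linear.linear[OF bounded_linear_slopes]])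

definition exp_sum ::
  "(real \<Rightarrow> real \<Rightarrow> real \<Rightarrow> real) \<Rightarrow> ('n::finite \<Rightarrow> nat) \<Rightarrow> real ^ 'n \<Rightarrow> real" where
  "exp_sum F lab u = (\<Sum>i\<in>UNIV. exp (G F lab u $ i))"

lemma phi_eq_exp_sum: "phi F lab u = mesh TYPE('n) * exp_sum F lab u" for u :: "real ^ 'n::finite"
  by (simp add: phi_def exp_sum_def sum_distrib_left)

lemma mesh_pos: "mesh TYPE('n::finite) > 0"
  by (simp add: mesh_def)

lemma G_has_derivative:
  assumes "\<And>x z. (\<lambda>(p, q). F p q x) differentiable (at z)"
  shows "(G F lab has_derivative linearization F lab u) (at u)"
proof -
  have "(\<lambda>u. G F lab u $ i) differentiable (at u)" for i
    unfolding G_nth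
    by (rule differentiable_compose[OF assms
          bounded_linear_imp_differentiable[OF bounded_linear_slopes]])
  then have "G F lab differentiable (at u)"
    by (subst differentiable_componentwise_within) (auto simp: Basis_vec_def inner_axis)
  then show ?thesis
    unfolding linearization_def by (simp add: frechet_derivative_works)
qed

text \<open>The chain rule, with the transpose moved to the other side of the inner product: the vector
  field of the discrete flow is minus the gradient of \<open>exp_sum\<close>.\<close>

lemma exp_sum_has_derivative:
  assumes "\<And>x z. (\<lambda>(p, q). F p q x) differentiable (at z)"
  shows "(exp_sum F lab has_derivative
    (\<lambda>v. adjoint (linearization F lab u) (\<chi> i. exp (G F lab u $ i)) \<bullet> v)) (at u)"
proof -
  let ?L = "linearization F lab u"
  note G = G_has_derivative[where F = F and lab = lab and u = u, OF assms]
  have "((\<lambda>u. exp (G F lab u $ i)) has_derivative (\<lambda>v. exp (G F lab u $ i) * ?L v $ i)) (at u)"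
    for i
  proof -
    have "((\<lambda>u. G F lab u $ i) has_derivative (\<lambda>v. ?L v $ i)) (at u)"
      by (rule bounded_linear.has_derivative[OF bounded_linear_vec_nth G])
    then show ?thesis by (auto intro!: derivative_eq_intros simp: mult.commute)
  qed
  then have "(exp_sum F lab has_derivative (\<lambda>v. \<Sum>i\<in>UNIV. exp (G F lab u $ i) * ?L v $ i)) (at u)"
    unfolding exp_sum_def by (intro has_derivative_sum)
  then show ?thesis
    unfolding adjoint_clauses(2)[OF has_derivative_linear[OF G]] by (simp add: inner_vec_def)
qed

lemma convex_exp_sum:
  fixes lab :: "'n::finite \<Rightarrow> nat"
  assumes conv: "\<And>x. convex_on UNIV (\<lambda>(p, q). F p q x)"
  shows "convex_on UNIV (exp_sum F lab)"
  unfolding convex_on_def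
proof (intro conjI ballI allI impI)
  fix u v :: "real ^ 'n" and a b :: real
  assume ab: "a \<ge> 0" "b \<ge> 0" "a + b = 1"
  have lin: "linear (slopes lab i)" for i by (rule bounded_linear.linear[OF bounded_linear_slopes])
  have "exp (G F lab (a *\<^sub>R u + b *\<^sub>R v) $ i)
      \<le> a * exp (G F lab u $ i) + b * exp (G F lab v $ i)" for i
  proof -
    have "G F lab (a *\<^sub>R u + b *\<^sub>R v) $ i \<le> a * G F lab u $ i + b * G F lab v $ i"
      unfolding G_nth linear_add[OF lin] linear_scale[OF lin]
      using conv[of "node lab i"] ab unfolding convex_on_def by blast
    then have "exp (G F lab (a *\<^sub>R u + b *\<^sub>R v) $ i) \<le> exp (a * G F lab u $ i + b * G F lab v $ i)"
      by simp
    also have "\<dots> \<le> a * exp (G F lab u $ i) + b * exp (G F lab v $ i)"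
      using exp_convex ab unfolding convex_on_def by simp
    finally show ?thesis .
  qed
  then show "exp_sum F lab (a *\<^sub>R u + b *\<^sub>R v) \<le> a * exp_sum F lab u + b * exp_sum F lab v"
    unfolding exp_sum_def sum_distrib_left sum.distrib[symmetric] by (rule sum_mono)
qed simp

text \<open>The components of the gradient sum to its inner product with the constant vector 1, that
  is, to the derivative of \<open>exp_sum\<close> in a direction in which it is constant.\<close>

lemma gradient_exp_sum_orthogonal:
  assumes "\<And>x z. (\<lambda>(p, q). F p q x) differentiable (at z)"
  shows "(\<Sum>i\<in>UNIV. adjoint (linearization F lab u) (\<chi> i. exp (G F lab u $ i)) $ i) = 0"
    (is "(\<Sum>i\<in>UNIV. ?g $ i) = 0")
proof -
  have "((\<lambda>s. exp_sum F lab (u + vec s)) has_derivative (\<lambda>s. ?g \<bullet> vec s)) (at (0::real))"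
  proof (rule has_derivative_compose[where g = "exp_sum F lab"])
    have "bounded_linear (vec :: real \<Rightarrow> real ^ 'n)"
      by (intro linear_conv_bounded_linear[THEN iffD1] linearI) (auto simp: vec_eq_iff)
    then have "((\<lambda>s. vec s :: real ^ 'n) has_derivative vec) (at 0)"
      by (rule bounded_linear_imp_has_derivative)
    from has_derivative_add[OF has_derivative_const[of u] this]
    show "((\<lambda>s. u + vec s) has_derivative vec) (at (0::real))" by simp
    have "vec 0 = (0 :: real ^ 'n)" by (simp add: vec_eq_iff)
    then show "(exp_sum F lab has_derivative (\<lambda>v. ?g \<bullet> v)) (at (u + vec 0))"
      using exp_sum_has_derivative[where F = F, OF assms] by simp
  qed
  moreover have "exp_sum F lab (u + vec s) = exp_sum F lab u" for s
    by (simp add: exp_sum_def G_add_vec)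
  ultimately have "((\<lambda>s::real. exp_sum F lab u) has_derivative (\<lambda>s. ?g \<bullet> vec s)) (at 0)"
    by simp
  then have "(\<lambda>s::real. ?g \<bullet> vec s) = (\<lambda>s. 0)"
    by (rule has_derivative_unique) simp
  from fun_cong[OF this, of 1] show ?thesis by (simp add: inner_vec_def)
qed

section \<open>Coercivity and existence of a minimiser\<close>

text \<open>The slope \<open>p\<close> between the nodes \<open>k\<close> and \<open>k + 1\<close> appears in \<open>G\<close> at both nodes, in exactly the
  two positions that the coercivity hypothesis on \<open>F\<close> couples.  Since \<open>G\<^sub>i \<le> exp (G\<^sub>i) \<le> exp_sum\<close>, both
  values of \<open>G\<close> are bounded above on a sublevel set.  The pair formed by the last and the first
  node is left out: the remaining pairs already join all nodes by a path.\<close>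

lemma exp_sum_bounds_increment:
  fixes lab :: "'n::finite \<Rightarrow> nat"
  assumes lab: "labelling lab"
    and c: "c > 0" "\<And>p q q' x x'. F (- p) q x + F q' p x' \<ge> - (1 / c) + c * p\<^sup>2"
    and M: "exp_sum F lab u \<le> M"
    and k: "1 \<le> k" "k < CARD('n)"
  shows "\<bar>u $ inv lab (Suc k) - u $ inv lab k\<bar> \<le> mesh TYPE('n) * sqrt ((2 * M + 1 / c) / c)"
proof -
  let ?h = "mesh TYPE('n)"
  define p where "p = (u $ inv lab (Suc k) - u $ inv lab k) / ?h"
  have lab_inv: "lab (inv lab j) = j" if "j \<in> {1..CARD('n)}" for j
    using lab that unfolding labelling_def bij_betw_def by (auto intro: f_inv_into_f)
  have G_le: "G F lab u $ i \<le> M" for i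
  proof -
    have "G F lab u $ i \<le> exp (G F lab u $ i)"
      using exp_ge_add_one_self[of "G F lab u $ i"] by linarith
    also have "\<dots> \<le> exp_sum F lab u"
      unfolding exp_sum_def by (rule member_le_sum) auto
    finally show ?thesis using M by simp
  qed
  have "\<exists>q. G F lab u $ inv lab k = F (- p) q (node lab (inv lab k))"
    using k lab_inv[of k] by (auto simp: G_def comp_def p_def minus_divide_left)
  moreover have "\<exists>q. G F lab u $ inv lab (Suc k) = F q p (node lab (inv lab (Suc k)))"
    using k lab_inv[of "Suc k"] by (auto simp: G_def comp_def p_def)
  ultimately have "- (1 / c) + c * p\<^sup>2 \<le> 2 * M"
    using c(2) G_le by (smt (verit))
  then have "p\<^sup>2 \<le> (2 * M + 1 / c) / c"
    using c(1) by (simp add: field_simps)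
  then have "\<bar>p\<bar> \<le> sqrt ((2 * M + 1 / c) / c)"
    using real_sqrt_le_mono by fastforce
  then show ?thesis
    using mesh_pos[where 'n = 'n] by (simp add: p_def field_simps)
qed

lemma abs_diff_le_steps:
  fixes a :: "nat \<Rightarrow> real"
  assumes "\<And>k. 1 \<le> k \<Longrightarrow> k < n \<Longrightarrow> \<bar>a (Suc k) - a k\<bar> \<le> K" "1 \<le> k" "k \<le> n"
  shows "\<bar>a k - a 1\<bar> \<le> real (k - 1) * K"
  using assms(2,3)
proof (induction k rule: dec_induct)
  case (step k)
  then have "\<bar>a (Suc k) - a k\<bar> \<le> K" "\<bar>a k - a 1\<bar> \<le> real (k - 1) * K"
    using assms(1) by auto
  then show ?case
    using step by (simp add: of_nat_diff algebra_simps)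
qed simp

lemma sublevel_slice_bounded:
  fixes lab :: "'n::finite \<Rightarrow> nat"
  assumes lab: "labelling lab"
    and coercive: "\<exists>c>0. \<forall>p q q' x x'. F (- p) q x + F q' p x' \<ge> - (1 / c) + c * p\<^sup>2"
  shows "bounded {u. (\<Sum>i\<in>UNIV. u $ i) = 0 \<and> exp_sum F lab u \<le> M}"
proof -
  obtain c where c: "c > 0" "\<And>p q q' x x'. F (- p) q x + F q' p x' \<ge> - (1 / c) + c * p\<^sup>2"
    using coercive by auto
  \<comment> \<open>For small \<open>M\<close> the sublevel set is empty and the radicand may be negative; the absolute
    value makes \<open>K\<close> nonnegative in every case.\<close>
  define K where "K = mesh TYPE('n) * \<bar>sqrt ((2 * M + 1 / c) / c)\<bar>"
  define R where "R = real CARD('n) * K"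
  have K0: "K \<ge> 0" unfolding K_def using mesh_pos[where 'n = 'n] by (intro mult_nonneg_nonneg) auto
  have "norm u \<le> real CARD('n) * (2 * R)"
    if u: "(\<Sum>i\<in>UNIV. u $ i) = 0" "exp_sum F lab u \<le> M" for u :: "real ^ 'n"
  proof -
    \<comment> \<open>All entries are close to the first one, and since they sum to zero the first one cannot be
      large.\<close>
    let ?a = "u $ inv lab 1"
    have near: "\<bar>u $ i - ?a\<bar> \<le> R" for i
    proof -
      have i: "1 \<le> lab i" "lab i \<le> CARD('n)" and inv: "inv lab (lab i) = i"
        using lab unfolding labelling_def bij_betw_def by auto
      have "\<bar>u $ inv lab (Suc k) - u $ inv lab k\<bar> \<le> K" if "1 \<le> k" "k < CARD('n)" for k
      proof -
        have "mesh TYPE('n) * sqrt ((2 * M + 1 / c) / c) \<le> K"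
          unfolding K_def using mesh_pos[where 'n = 'n] by (intro mult_left_mono) auto
        then show ?thesis
          using exp_sum_bounds_increment[where F = F, OF lab c u(2) that] by linarith
      qed
      then have "\<bar>u $ inv lab (lab i) - ?a\<bar> \<le> real (lab i - 1) * K"
        using i by (rule abs_diff_le_steps)
      also have "\<dots> \<le> R"
        unfolding R_def using K0 i by (intro mult_right_mono) auto
      finally show ?thesis by (simp add: inv)
    qed
    have "real CARD('n) * \<bar>?a\<bar> = \<bar>\<Sum>i\<in>UNIV. u $ i - ?a\<bar>"
      by (simp add: sum_subtractf u abs_mult)
    also have "\<dots> \<le> (\<Sum>i\<in>UNIV. \<bar>u $ i - ?a\<bar>)" by (rule sum_abs)
    also have "\<dots> \<le> real CARD('n) * R" using sum_mono[of UNIV, OF near] by simp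
    finally have "\<bar>?a\<bar> \<le> R" by simp
    then have "\<bar>u $ i\<bar> \<le> 2 * R" for i using near[of i] by linarith
    then have "(\<Sum>i\<in>UNIV. \<bar>u $ i\<bar>) \<le> real CARD('n) * (2 * R)"
      using sum_mono[of UNIV "\<lambda>i. \<bar>u $ i\<bar>" "\<lambda>_. 2 * R"] by simp
    then show ?thesis using norm_le_l1_cart[of u] by linarith
  qed
  then show ?thesis unfolding bounded_iff by auto
qed

text \<open>A minimum over the compact slice of vectors with vanishing sum is a global one, because
  subtracting the mean moves every vector into the hyperplane without changing \<open>exp_sum\<close>.\<close>

lemma exp_sum_attains_minimum:
  fixes lab :: "'n::finite \<Rightarrow> nat"
  assumes diff: "\<And>x z. (\<lambda>(p, q). F p q x) differentiable (at z)"
    and lab: "labelling lab"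
    and coercive: "\<exists>c>0. \<forall>p q q' x x'. F (- p) q x + F q' p x' \<ge> - (1 / c) + c * p\<^sup>2"
  obtains z where "\<And>u. exp_sum F lab z \<le> exp_sum F lab u"
proof -
  let ?f = "exp_sum F lab"
  let ?S = "{u. (\<Sum>i\<in>UNIV. u $ i) = 0 \<and> ?f u \<le> ?f 0}"
  have cont: "continuous_on A ?f" for A
    using has_derivative_continuous[OF exp_sum_has_derivative[where F = F, OF diff]]
    by (blast intro: continuous_at_imp_continuous_on)
  have "closed ?S"
    by (intro closed_Collect_conj closed_Collect_eq closed_Collect_le cont continuous_intros)
  then have "compact ?S"
    using sublevel_slice_bounded[where F = F, OF lab coercive] compact_eq_bounded_closed by blast
  moreover have "0 \<in> ?S" by simp
  ultimately obtain z where z: "z \<in> ?S" "\<And>y. y \<in> ?S \<Longrightarrow> ?f z \<le> ?f y"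
    using continuous_attains_inf[OF _ _ cont, of ?S] by blast
  have "?f z \<le> ?f v" for v
  proof -
    define v0 where "v0 = v + vec (- (\<Sum>i\<in>UNIV. v $ i) / real CARD('n))"
    have "(\<Sum>i\<in>UNIV. v0 $ i) = 0" by (simp add: v0_def sum.distrib sum_subtractf)
    then have "?f z \<le> ?f v0" using z(2)[of v0] z(2)[OF \<open>0 \<in> ?S\<close>] by (cases "?f v0 \<le> ?f 0") auto
    also have "?f v0 = ?f v" by (simp add: v0_def exp_sum_def G_add_vec)
    finally show ?thesis .
  qed
  then show ?thesis by (rule that)
qed

section \<open>Convergence of the discrete gradient flow\<close>

theorem mainTheorem2:
  fixes V b :: "real \<Rightarrow> real"
    and F :: "real \<Rightarrow> real \<Rightarrow> real \<Rightarrow> real"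
    and lab :: "'n::finite \<Rightarrow> nat"
    and u u' mt :: "real \<Rightarrow> real ^ 'n"
  assumes V: "on_circle V" "smooth V"
    and b: "on_circle b" "smooth b"
    and F_circle: "\<And>p q. on_circle (\<lambda>x. F p q x)"
    and F_diff: "\<And>x z. (\<lambda>(p, q). F p q x) differentiable (at z)"
    and F_convex: "\<And>x. convex_on UNIV (\<lambda>(p, q). F p q x)"
    and F_mono_p: "\<And>q x. mono (\<lambda>p. F p q x)"
    and F_mono_q: "\<And>p x. mono (\<lambda>q. F p q x)"
    and F_consistent: "\<And>p x. F (- p) p x = p\<^sup>2 / 2 + b x * p + V x"
    and F_coercive: "\<exists>c>0. \<forall>p q q' x x'. F (- p) q x + F q' p x' \<ge> - (1 / c) + c * p\<^sup>2"
    and lab: "labelling lab"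
    and u_deriv: "\<And>t. t \<ge> 0 \<Longrightarrow> (u has_vector_derivative u' t) (at t within {0..})"
    and u_C1: "continuous_on {0..} u'"
    and mt: "\<And>t i. t \<ge> 0 \<Longrightarrow> mt t $ i = exp (G F lab (u t) $ i)"
    and flow: "\<And>t i. t \<ge> 0 \<Longrightarrow> u' t $ i = - (adjoint (linearization F lab (u t)) (mt t) $ i)"
  shows "antimono_on {0..} (\<lambda>t. phi F lab (u t)) \<and>
    (\<forall>t\<ge>0. ((\<lambda>s. \<Sum>i\<in>UNIV. u s $ i) has_real_derivative 0) (at t within {0..})) \<and>
    bounded (u ` {0..}) \<and>
    (\<exists>uinf. (u \<longlongrightarrow> uinf) at_top \<and> critical_point (phi F lab) uinf \<and>
      (\<exists>!Hbar. mesh TYPE('n) * (\<Sum>i\<in>UNIV. exp (- Hbar) * exp (G F lab uinf $ i)) = 1) \<and>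
      (\<forall>Hbar m.
        (\<forall>i. m $ i = exp (- Hbar) * exp (G F lab uinf $ i)) \<and>
        mesh TYPE('n) * (\<Sum>i\<in>UNIV. m $ i) = 1 \<longrightarrow>
        (\<forall>i. G F lab uinf $ i = ln (m $ i) + Hbar \<and>
             adjoint (linearization F lab uinf) m $ i = 0)))"
proof -
  let ?h = "mesh TYPE('n)"
  let ?L = "linearization F lab"
  define g where "g = (\<lambda>v. adjoint (?L v) (\<chi> i. exp (G F lab v $ i)))"
  note h = mesh_pos[where 'n = 'n]
  have g: "(exp_sum F lab has_derivative (\<lambda>w. g v \<bullet> w)) (at v)" for v
    unfolding g_def by (rule exp_sum_has_derivative[where F = F, OF F_diff])
  have u': "u' t = - g (u t)" if "t \<ge> 0" for t
  proof -
    have mt_eq: "mt t = (\<chi> i. exp (G F lab (u t) $ i))" using mt[OF that] by (simp add: vec_eq_iff)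
    show ?thesis using flow[OF that] unfolding vec_eq_iff g_def mt_eq by simp
  qed
  interpret convex_gradient_flow "exp_sum F lab" g u
    using convex_exp_sum[where F = F, OF F_convex] g u_deriv u' by unfold_locales auto
  obtain z where z: "\<And>v. exp_sum F lab z \<le> exp_sum F lab v"
    using exp_sum_attains_minimum[where F = F, OF F_diff lab F_coercive] by blast
  obtain w where lim: "(u \<longlongrightarrow> w) at_top" and w: "\<And>v. exp_sum F lab w \<le> exp_sum F lab v"
    using converges_to_minimiser[OF z] by blast
  have "(\<lambda>v. g w \<bullet> v) = (\<lambda>v. 0)"
    using differential_zero_maxmin[OF _ _ g] w by blast
  then have gw: "g w = 0" by (metis inner_eq_zero_iff)

  have "antimono_on {0..} (\<lambda>t. phi F lab (u t))"
    using energy_antimono h by (auto intro!: monotone_onI simp: phi_eq_exp_sum)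
  moreover have "((\<lambda>s. \<Sum>i\<in>UNIV. u s $ i) has_real_derivative 0) (at t within {0..})"
    if "t \<ge> 0" for t
  proof -
    have "((\<lambda>s. \<Sum>i\<in>UNIV. u s $ i) has_vector_derivative (\<Sum>i\<in>UNIV. u' t $ i)) (at t within {0..})"
      by (intro has_vector_derivative_sum u_deriv that
          bounded_linear.has_vector_derivative[OF bounded_linear_vec_nth])
    moreover have "(\<Sum>i\<in>UNIV. u' t $ i) = 0"
      using gradient_exp_sum_orthogonal[where F = F and lab = lab and u = "u t", OF F_diff]
      by (simp add: u'[OF that] g_def sum_negf)
    ultimately show ?thesis by (simp add: has_real_derivative_iff_has_vector_derivative)
  qed
  moreover have "bounded (u ` {0..})" using trajectory_bounded[OF z] .
  moreover have "critical_point (phi F lab) w"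
  proof -
    have "phi F lab = (\<lambda>v. ?h * exp_sum F lab v)" by (simp add: fun_eq_iff phi_eq_exp_sum)
    then have "(phi F lab has_derivative (\<lambda>v. 0)) (at w)"
      using has_derivative_mult_right[OF g[of w], of ?h] by (simp add: gw)
    then show ?thesis
      unfolding critical_point_def gradient_def
      by (auto simp: differentiable_def frechet_derivative_at[symmetric] vec_eq_iff)
  qed
  moreover have "\<exists>!Hbar. ?h * (\<Sum>i\<in>UNIV. exp (- Hbar) * exp (G F lab w $ i)) = 1"
  proof -
    have "exp_sum F lab w > 0" unfolding exp_sum_def by (rule sum_pos) auto
    then have pos: "?h * exp_sum F lab w > 0" using h by simp
    have eq: "?h * (\<Sum>i\<in>UNIV. exp (- Hbar) * exp (G F lab w $ i)) = 1
        \<longleftrightarrow> Hbar = ln (?h * exp_sum F lab w)" for Hbar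
    proof -
      have "?h * (\<Sum>i\<in>UNIV. exp (- Hbar) * exp (G F lab w $ i)) = ?h * exp_sum F lab w / exp Hbar"
        by (simp add: exp_sum_def exp_minus sum_distrib_left[symmetric] divide_inverse)
      also have "\<dots> = 1 \<longleftrightarrow> exp Hbar = ?h * exp_sum F lab w" by (auto simp: field_simps)
      also have "\<dots> \<longleftrightarrow> Hbar = ln (?h * exp_sum F lab w)" using pos by (metis exp_ln ln_exp)
      finally show ?thesis .
    qed
    show ?thesis unfolding eq by simp
  qed
  moreover have "G F lab w $ i = ln (m $ i) + Hbar \<and> adjoint (?L w) m $ i = 0"
    if m: "\<forall>i. m $ i = exp (- Hbar) * exp (G F lab w $ i)" for Hbar m i
  proof -
    have "m = exp (- Hbar) *\<^sub>R (\<chi> i. exp (G F lab w $ i))" using m by (simp add: vec_eq_iff)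
    moreover have "linear (adjoint (?L w))"
      by (intro adjoint_linear has_derivative_linear[OF G_has_derivative] F_diff)
    ultimately have "adjoint (?L w) m = 0"
      using gw by (simp add: linear_scale g_def)
    moreover have "ln (m $ i) = G F lab w $ i - Hbar"
      using m by (simp add: exp_add[symmetric])
    ultimately show ?thesis by simp
  qed
  ultimately show ?thesis using lim by blast
qed

end
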